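(* Let $G$ be a finite group and $k$ a field. If $V$ and $W$ are finite-dimensional representations of $G$ over $k$ such that $V$ is faithful and there is a surjective $kG$-module homomorphism $W\to V$, then $$D_{\mathrm{span}}(G,W)\leq D_{\mathrm{span}}(G,V).$$
   Context: For a finite-dimensional representation $V$ of a finite group $G$ over a field $k$: $k[V]$ is the ring of polynomial functions on $V$ (the symmetric algebra of $V^*$), with $G$-action $(gf)(v)=f(g^{-1}v)$; $k(V)$ is its fraction field and $k(V)^G$ the field of $G$-invariant rational functions; $k[V]_{\le d}$ is the space of polynomials of degree at most $d$. The spanning degree $D_{\mathrm{span}}(G,V)$ is the minimum $d\in\mathbb{N}=\{0,1,2,\dots\}$ such that $k[V]_{\le d}$ spans $k(V)$ as a vector space over $k(V)^G$. *)

theory Defs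
  imports
    Complex_Main
    "HOL-Library.Poly_Mapping"
    "HOL-Computational_Algebra.Fraction_Field"
    "HOL-Algebra.Group_Action"
begin

text \<open>
  Polynomials over \<open>k\<close> in the indeterminates \<open>x\<^sub>0, x\<^sub>1, \<dots>\<close> are finitely supported functions from
  exponent vectors to coefficients. The library makes this type an integral domain, so its field
  of fractions is available as \<open>'k mpoly fract\<close>. For a representation of dimension \<open>n\<close>, possibly
  \<open>0\<close>, only \<open>x\<^sub>0, \<dots>, x\<^sub>n\<^sub>-\<^sub>1\<close> are used; this is why the indeterminates are indexed by \<open>nat\<close> and not
  by a type of size \<open>n\<close>.
\<close>

type_synonym 'k mpoly = "(nat \<Rightarrow>\<^sub>0 nat) \<Rightarrow>\<^sub>0 'k"

definition Const :: "'k \<Rightarrow> 'k::field mpoly" where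
  "Const c = Poly_Mapping.single 0 c"

definition Var :: "nat \<Rightarrow> 'k::field mpoly" where
  "Var i = Poly_Mapping.single (Poly_Mapping.single i 1) 1"

definition indets :: "'k::field mpoly \<Rightarrow> nat set" where
  "indets p = (\<Union>m\<in>Poly_Mapping.keys p. Poly_Mapping.keys m)"

definition total_degree_le :: "'k::field mpoly \<Rightarrow> nat \<Rightarrow> bool" where
  "total_degree_le p d \<longleftrightarrow>
     (\<forall>m\<in>Poly_Mapping.keys p. (\<Sum>i\<in>Poly_Mapping.keys m. Poly_Mapping.lookup m i) \<le> d)"

definition monom_eval :: "(nat \<Rightarrow> 'r::comm_ring_1) \<Rightarrow> (nat \<Rightarrow>\<^sub>0 nat) \<Rightarrow> 'r" where
  "monom_eval \<sigma> m = (\<Prod>i\<in>Poly_Mapping.keys m. \<sigma> i ^ Poly_Mapping.lookup m i)"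

text \<open>
  Replaces \<open>x\<^sub>i\<close> by \<open>\<sigma> i\<close>, with coefficients mapped by \<open>\<iota>\<close>: this is evaluation at a point when \<open>\<iota>\<close>
  is the identity, and substitution of polynomials when \<open>\<iota>\<close> is \<open>Const\<close>.
\<close>

definition poly_eval :: "('k::field \<Rightarrow> 'r::comm_ring_1) \<Rightarrow> (nat \<Rightarrow> 'r) \<Rightarrow> 'k mpoly \<Rightarrow> 'r" where
  "poly_eval \<iota> \<sigma> p =
     (\<Sum>m\<in>Poly_Mapping.keys p. \<iota> (Poly_Mapping.lookup p m) * monom_eval \<sigma> m)"

lemma poly_eval_superset:
  assumes "finite S" "Poly_Mapping.keys p \<subseteq> S" "\<iota> 0 = 0"
  shows "poly_eval \<iota> \<sigma> p = (\<Sum>m\<in>S. \<iota> (Poly_Mapping.lookup p m) * monom_eval \<sigma> m)"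
  unfolding poly_eval_def
  by (rule sum.mono_neutral_left) (use assms in \<open>auto simp: in_keys_iff\<close>)

lemma monom_eval_superset:
  assumes "finite S" "Poly_Mapping.keys m \<subseteq> S"
  shows "monom_eval \<sigma> m = (\<Prod>i\<in>S. \<sigma> i ^ Poly_Mapping.lookup m i)"
  unfolding monom_eval_def
  by (rule prod.mono_neutral_left) (use assms in \<open>auto simp: in_keys_iff\<close>)

lemma monom_eval_zero [simp]: "monom_eval \<sigma> 0 = 1"
  by (simp add: monom_eval_def)

lemma monom_eval_add: "monom_eval \<sigma> (m + n) = monom_eval \<sigma> m * monom_eval \<sigma> n"
proof -
  let ?S = "Poly_Mapping.keys m \<union> Poly_Mapping.keys n"
  have "Poly_Mapping.keys (m + n) \<subseteq> ?S" by (rule keys_add)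
  then show ?thesis
    by (simp add: monom_eval_superset[where S = ?S] lookup_add power_add prod.distrib)
qed

lemma mpoly_induct [case_names single add]:
  fixes p :: "'k::field mpoly"
  assumes "\<And>m c. P (Poly_Mapping.single m c)"
    and "\<And>p q. P p \<Longrightarrow> P q \<Longrightarrow> P (p + q)"
  shows "P p"
proof (induction p rule: update_induct)
  case const
  show ?case using assms(1)[of 0 0] by simp
next
  case (update f a b)
  have "Poly_Mapping.update a b f = f + Poly_Mapping.single a b"
    using update.hyps
    by (intro poly_mapping_eqI) (auto simp: lookup_update lookup_add lookup_single in_keys_iff when_def)
  then show ?case using assms update.IH by metis
qed

locale coeff_hom =
  fixes \<iota> :: "'k::field \<Rightarrow> 'r::comm_ring_1"
  assumes map_zero: "\<iota> 0 = 0" and map_one: "\<iota> 1 = 1"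
    and map_add: "\<iota> (a + b) = \<iota> a + \<iota> b" and map_mult: "\<iota> (a * b) = \<iota> a * \<iota> b"
begin

lemma eval_single: "poly_eval \<iota> \<sigma> (Poly_Mapping.single m c) = \<iota> c * monom_eval \<sigma> m"
  by (subst poly_eval_superset[where S = "{m}"]) (auto simp: map_zero)

lemma eval_zero: "poly_eval \<iota> \<sigma> 0 = 0"
  by (simp add: poly_eval_def)

lemma eval_Const: "poly_eval \<iota> \<sigma> (Const c) = \<iota> c"
  by (simp add: Const_def eval_single)

lemma eval_Var: "poly_eval \<iota> \<sigma> (Var i) = \<sigma> i"
  by (simp add: Var_def eval_single map_one monom_eval_def)

lemma eval_add: "poly_eval \<iota> \<sigma> (p + q) = poly_eval \<iota> \<sigma> p + poly_eval \<iota> \<sigma> q"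
proof -
  let ?S = "Poly_Mapping.keys p \<union> Poly_Mapping.keys q"
  have "Poly_Mapping.keys (p + q) \<subseteq> ?S" by (rule keys_add)
  then show ?thesis
    by (simp add: poly_eval_superset[where S = ?S] map_zero lookup_add map_add
        distrib_right sum.distrib)
qed

lemma eval_mult: "poly_eval \<iota> \<sigma> (p * q) = poly_eval \<iota> \<sigma> p * poly_eval \<iota> \<sigma> q"
proof (induction p rule: mpoly_induct)
  case (single m c)
  show ?case
  proof (induction q rule: mpoly_induct)
    case (single n d)
    show ?case by (simp add: mult_single eval_single map_mult monom_eval_add mult_ac)
  next
    case (add q q')
    then show ?case by (simp add: distrib_left eval_add)
  qed
next
  case (add p p')
  then show ?case by (simp add: distrib_right eval_add)
qed

lemma eval_sum: "poly_eval \<iota> \<sigma> (sum f A) = (\<Sum>a\<in>A. poly_eval \<iota> \<sigma> (f a))"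
  by (induction A rule: infinite_finite_induct) (simp_all add: eval_zero eval_add)

lemma eval_one: "poly_eval \<iota> \<sigma> 1 = 1"
  using eval_Const[of \<sigma> 1] by (simp add: Const_def map_one)

lemma eval_power: "poly_eval \<iota> \<sigma> (p ^ n) = poly_eval \<iota> \<sigma> p ^ n"
  by (induction n) (simp_all add: eval_one eval_mult)

lemma eval_prod: "poly_eval \<iota> \<sigma> (prod f A) = (\<Prod>a\<in>A. poly_eval \<iota> \<sigma> (f a))"
  by (induction A rule: infinite_finite_induct) (simp_all add: eval_one eval_mult)

lemma eval_subst:
  "poly_eval \<iota> \<tau> (poly_eval Const \<sigma> p) = poly_eval \<iota> (\<lambda>i. poly_eval \<iota> \<tau> (\<sigma> i)) p"
  unfolding poly_eval_def[of Const] poly_eval_def[of \<iota> "\<lambda>i. poly_eval \<iota> \<tau> (\<sigma> i)"]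
  by (simp add: eval_sum eval_mult eval_Const monom_eval_def eval_prod eval_power)

end

lemma poly_eval_cong:
  assumes "\<And>i. i \<in> indets p \<Longrightarrow> \<sigma> i = \<tau> i"
  shows "poly_eval \<iota> \<sigma> p = poly_eval \<iota> \<tau> p"
  unfolding poly_eval_def monom_eval_def
  by (intro sum.cong arg_cong2[where f = "(*)"] prod.cong refl arg_cong[where f = "\<lambda>x. x ^ _"] assms)
    (auto simp: indets_def)

interpretation Const: coeff_hom Const
  by unfold_locales (simp_all add: Const_def single_add mult_single)

interpretation id_hom: coeff_hom "\<lambda>c :: 'k::field. c"
  by unfold_locales simp_all

lemma monom_eval_Var: "monom_eval Var m = Poly_Mapping.single m (1 :: 'k::field)"
proof -
  have pow: "(Var i :: 'k mpoly) ^ n = Poly_Mapping.single (Poly_Mapping.single i n) 1" for i n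
    by (induction n) (simp_all add: Var_def mult_single flip: single_add)
  have "(\<Prod>i\<in>S. Poly_Mapping.single (f i) (1 :: 'k)) = Poly_Mapping.single (sum f S) 1"
    if "finite S" for S and f :: "nat \<Rightarrow> nat \<Rightarrow>\<^sub>0 nat"
    using that by induction (simp_all add: mult_single)
  moreover have "(\<Sum>i\<in>Poly_Mapping.keys m. Poly_Mapping.single i (Poly_Mapping.lookup m i)) = m"
    by (rule poly_mapping_eqI) (auto simp: lookup_sum lookup_single when_def in_keys_iff)
  ultimately show ?thesis by (simp add: monom_eval_def pow)
qed

lemma poly_eval_Var: "poly_eval Const Var p = p"
proof (induction p rule: mpoly_induct)
  case (single m c)
  show ?case by (simp add: Const.eval_single monom_eval_Var) (simp add: Const_def mult_single)
qed (simp add: Const.eval_add)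

text \<open>
  In a field (here: a field of fractions), the linear combinations of elements of \<open>S\<close> with
  coefficients in the subfield \<open>K\<close>. The library's \<open>span\<close> needs the scalars to form a type.
\<close>

definition span_over :: "'f::field set \<Rightarrow> 'f set \<Rightarrow> 'f set" where
  "span_over K S = {(\<Sum>s\<in>T. c s * s) |T c. finite T \<and> T \<subseteq> S \<and> c ` T \<subseteq> K}"

text \<open>
  A finite-dimensional representation of \<open>G\<close> on the \<open>k\<close>-vector space formed by the type \<open>'v\<close>,
  together with an ordered basis \<open>bs\<close>. The basis identifies \<open>k[V]\<close>, the symmetric algebra of
  \<open>V\<^sup>*\<close>, with \<open>k[x\<^sub>0, \<dots>, x\<^sub>n\<^sub>-\<^sub>1]\<close>, where \<open>x\<^sub>i\<close> is the \<open>i\<close>-th coordinate function. Elements of \<open>k[V]\<close>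
  are formal polynomials, which matters when \<open>k\<close> is finite.
\<close>

locale fin_dim_rep = vector_space scale + group_action G UNIV \<rho>
  for G (structure)
    and scale :: "'k::field \<Rightarrow> 'v::ab_group_add \<Rightarrow> 'v"
    and \<rho> :: "'g \<Rightarrow> 'v \<Rightarrow> 'v" +
  fixes bs :: "'v list"
  assumes linear_action: "g \<in> carrier G \<Longrightarrow> Vector_Spaces.linear scale scale (\<rho> g)"
    and distinct_basis: "distinct bs"
    and independent_basis: "independent (set bs)"
    and span_basis: "span (set bs) = UNIV"
begin

definition coord :: "nat \<Rightarrow> 'v \<Rightarrow> 'k" where
  "coord i v = representation (set bs) v (bs ! i)"

definition poly_ring :: "'k mpoly set" where
  "poly_ring = {p. indets p \<subseteq> {..<length bs}}"

definition poly_ring_le :: "nat \<Rightarrow> 'k mpoly set" where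
  "poly_ring_le d = {p \<in> poly_ring. total_degree_le p d}"

text \<open>\<open>g\<close> sends \<open>x\<^sub>i\<close> to the linear form \<open>v \<mapsto> x\<^sub>i (g\<^sup>-\<^sup>1 v)\<close>; cf. \<open>eval_poly_act\<close> below.\<close>

definition poly_act :: "'g \<Rightarrow> 'k mpoly \<Rightarrow> 'k mpoly" where
  "poly_act g =
     poly_eval Const (\<lambda>i. \<Sum>j<length bs. Const (coord i (\<rho> (inv\<^bsub>G\<^esub> g) (bs ! j))) * Var j)"

definition frac_field :: "'k mpoly fract set" where
  "frac_field = {Fract p q |p q. p \<in> poly_ring \<and> q \<in> poly_ring \<and> q \<noteq> 0}"

text \<open>The induced action \<open>g (p / q) = (g p) / (g q)\<close>; cf. \<open>frac_act_Fract\<close> below.\<close>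

definition frac_act :: "'g \<Rightarrow> 'k mpoly fract \<Rightarrow> 'k mpoly fract" where
  "frac_act g f = (THE h. \<forall>p\<in>poly_ring. \<forall>q\<in>poly_ring.
     q \<noteq> 0 \<and> f = Fract p q \<longrightarrow> h = Fract (poly_act g p) (poly_act g q))"

lemma coord_basis: "i < length bs \<Longrightarrow> j < length bs \<Longrightarrow> coord i (bs ! j) = (if i = j then 1 else 0)"
  using distinct_basis independent_basis
  by (auto simp: coord_def representation_basis nth_eq_iff_index_eq)

lemma coord_expansion: "v = (\<Sum>j<length bs. scale (coord j v) (bs ! j))"
proof -
  have "v = (\<Sum>b\<in>set bs. scale (representation (set bs) v b) b)"
    using sum_representation_eq[of "set bs" v "set bs"] independent_basis span_basis by simp
  also have "\<dots> = (\<Sum>j<length bs. scale (coord j v) (bs ! j))"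
    unfolding coord_def
    by (rule sum.reindex_bij_betw[symmetric])
      (metis bij_betw_nth distinct_basis)
  finally show ?thesis .
qed

lemma coord_linear: "coord i (\<Sum>j\<in>A. scale (c j) (f j)) = (\<Sum>j\<in>A. c j * coord i (f j))"
proof -
  have add: "coord i (u + v) = coord i u + coord i v" for u v
    using independent_basis span_basis by (simp add: coord_def representation_add)
  have scl: "coord i (scale a u) = a * coord i u" for a u
    using independent_basis span_basis by (simp add: coord_def representation_scale)
  have zero: "coord i 0 = 0" by (simp add: coord_def representation_zero)
  show ?thesis
    by (induction A rule: infinite_finite_induct) (simp_all add: zero add scl)
qed

lemma coord_action:
  assumes "g \<in> carrier G"
  shows "coord i (\<rho> g v) = (\<Sum>j<length bs. coord j v * coord i (\<rho> g (bs ! j)))"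
proof -
  interpret lin: Vector_Spaces.linear scale scale "\<rho> g"
    using assms by (rule linear_action)
  have "\<rho> g v = (\<Sum>j<length bs. scale (coord j v) (\<rho> g (bs ! j)))"
    using arg_cong[OF coord_expansion[of v], of "\<rho> g"] by (simp add: lin.sum lin.scale)
  then show ?thesis by (simp add: coord_linear)
qed

text \<open>The defining formula \<open>(g f)(v) = f(g\<^sup>-\<^sup>1 v)\<close> of the action.\<close>

lemma eval_poly_act:
  assumes "g \<in> carrier G"
  shows "poly_eval (\<lambda>c. c) (\<lambda>i. coord i v) (poly_act g p)
           = poly_eval (\<lambda>c. c) (\<lambda>i. coord i (\<rho> (inv\<^bsub>G\<^esub> g) v)) p"
proof -
  interpret group_hom G "BijGroup UNIV" \<rho> by (rule group_hom)
  have "inv\<^bsub>G\<^esub> g \<in> carrier G" using assms by simp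
  then show ?thesis
    by (simp add: poly_act_def id_hom.eval_subst id_hom.eval_sum id_hom.eval_mult
        id_hom.eval_Const id_hom.eval_Var coord_action[of "inv\<^bsub>G\<^esub> g" _ v] mult.commute)
qed

lemma poly_act_mult: "poly_act g (p * q) = poly_act g p * poly_act g q"
  by (simp add: poly_act_def Const.eval_mult)

lemma poly_act_compose:
  assumes "g \<in> carrier G" "h \<in> carrier G"
  shows "poly_act g (poly_act h p) = poly_act (g \<otimes>\<^bsub>G\<^esub> h) p"
proof -
  interpret group_hom G "BijGroup UNIV" \<rho> by (rule group_hom)
  have inv: "inv\<^bsub>G\<^esub> (g \<otimes>\<^bsub>G\<^esub> h) = inv\<^bsub>G\<^esub> h \<otimes>\<^bsub>G\<^esub> inv\<^bsub>G\<^esub> g"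
    using assms by (simp add: G.inv_mult_group)
  have comp: "\<rho> (inv\<^bsub>G\<^esub> (g \<otimes>\<^bsub>G\<^esub> h)) v = \<rho> (inv\<^bsub>G\<^esub> h) (\<rho> (inv\<^bsub>G\<^esub> g) v)" for v
    unfolding inv using assms by (intro composition_rule) auto
  have sum_Const: "Const (sum f A) = (\<Sum>a\<in>A. Const (f a))" for f :: "nat \<Rightarrow> 'k" and A
    by (induction A rule: infinite_finite_induct) (simp_all add: Const.map_zero Const.map_add)
  have "(\<Sum>j<length bs. Const (coord i (\<rho> (inv\<^bsub>G\<^esub> h) (bs ! j))) *
            (\<Sum>l<length bs. Const (coord j (\<rho> (inv\<^bsub>G\<^esub> g) (bs ! l))) * Var l))
        = (\<Sum>l<length bs. Const (coord i (\<rho> (inv\<^bsub>G\<^esub> (g \<otimes>\<^bsub>G\<^esub> h)) (bs ! l))) * Var l)"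
    (is "?L = ?R") for i
  proof -
    have "?L = (\<Sum>l<length bs. \<Sum>j<length bs. Const (coord i (\<rho> (inv\<^bsub>G\<^esub> h) (bs ! j))) *
            (Const (coord j (\<rho> (inv\<^bsub>G\<^esub> g) (bs ! l))) * Var l))"
      by (simp only: sum_distrib_left) (rule sum.swap)
    also have "\<dots> = ?R"
    proof (rule sum.cong[OF refl])
      fix l
      have "coord i (\<rho> (inv\<^bsub>G\<^esub> (g \<otimes>\<^bsub>G\<^esub> h)) (bs ! l)) =
          (\<Sum>j<length bs. coord j (\<rho> (inv\<^bsub>G\<^esub> g) (bs ! l)) * coord i (\<rho> (inv\<^bsub>G\<^esub> h) (bs ! j)))"
        unfolding comp using assms by (intro coord_action) simp
      then show "(\<Sum>j<length bs. Const (coord i (\<rho> (inv\<^bsub>G\<^esub> h) (bs ! j))) *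
            (Const (coord j (\<rho> (inv\<^bsub>G\<^esub> g) (bs ! l))) * Var l)) =
          Const (coord i (\<rho> (inv\<^bsub>G\<^esub> (g \<otimes>\<^bsub>G\<^esub> h)) (bs ! l))) * Var l"
        by (simp only: sum_Const Const.map_mult sum_distrib_right) (simp add: mult_ac)
    qed
    finally show ?thesis .
  qed
  then show ?thesis
    by (simp add: poly_act_def Const.eval_subst Const.eval_sum Const.eval_mult
        Const.eval_Const Const.eval_Var)
qed

lemma poly_act_one:
  assumes "p \<in> poly_ring"
  shows "poly_act \<one>\<^bsub>G\<^esub> p = p"
proof -
  interpret group_hom G "BijGroup UNIV" \<rho> by (rule group_hom)
  have one: "\<rho> \<one>\<^bsub>G\<^esub> v = v" for v
    using id_eq_one by (metis UNIV_I restrict_apply')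
  have "(\<Sum>j<length bs. Const (coord i (bs ! j)) * Var j) = Var i" if "i < length bs" for i
  proof -
    have "(\<Sum>j<length bs. Const (coord i (bs ! j)) * Var j)
            = (\<Sum>j<length bs. if i = j then Var j else 0)"
      using that by (intro sum.cong) (auto simp: coord_basis Const.map_zero Const.map_one)
    then show ?thesis using that by simp
  qed
  then have "poly_act \<one>\<^bsub>G\<^esub> p = poly_eval Const Var p"
    unfolding poly_act_def using assms
    by (intro poly_eval_cong) (auto simp: one poly_ring_def simp del: hom_one)
  then show ?thesis by (simp add: poly_eval_Var)
qed

lemma poly_act_nonzero:
  assumes "g \<in> carrier G" "q \<in> poly_ring" "q \<noteq> 0"
  shows "poly_act g q \<noteq> 0"
proof
  interpret group_hom G "BijGroup UNIV" \<rho> by (rule group_hom)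
  assume "poly_act g q = 0"
  moreover have "poly_act (inv\<^bsub>G\<^esub> g) (poly_act g q) = q"
    using assms by (simp add: poly_act_compose poly_act_one)
  ultimately show False
    using assms(3) by (simp add: poly_act_def Const.eval_zero)
qed

lemma frac_act_Fract:
  assumes "g \<in> carrier G" "p \<in> poly_ring" "q \<in> poly_ring" "q \<noteq> 0"
  shows "frac_act g (Fract p q) = Fract (poly_act g p) (poly_act g q)"
  unfolding frac_act_def
proof (rule the_equality)
  show "\<forall>p'\<in>poly_ring. \<forall>q'\<in>poly_ring. q' \<noteq> 0 \<and> Fract p q = Fract p' q' \<longrightarrow>
      Fract (poly_act g p) (poly_act g q) = Fract (poly_act g p') (poly_act g q')"
  proof (intro ballI impI)
    fix p' q' assume *: "p' \<in> poly_ring" "q' \<in> poly_ring" "q' \<noteq> 0 \<and> Fract p q = Fract p' q'"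
    then have "p * q' = p' * q" using assms eq_fract(1)[of q q' p p'] by blast
    then have "poly_act g p * poly_act g q' = poly_act g p' * poly_act g q"
      by (metis poly_act_mult)
    then show "Fract (poly_act g p) (poly_act g q) = Fract (poly_act g p') (poly_act g q')"
      using * assms by (simp add: eq_fract(1) poly_act_nonzero)
  qed
qed (use assms in blast)

definition invariant_field :: "'k mpoly fract set" where
  "invariant_field = {f \<in> frac_field. \<forall>g\<in>carrier G. frac_act g f = f}"

text \<open>
  The value does not depend on \<open>bs\<close>, since a change of basis induces a degree-preserving
  equivariant isomorphism of polynomial rings.
  For finite \<open>G\<close> some \<open>d\<close> satisfies the condition, because \<open>k(V)\<close> is
  then a finite extension of \<open>k(V)\<^sup>G\<close> and is spanned over it by \<open>k[V]\<close>.
\<close>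

definition spanning_degree :: nat where
  "spanning_degree =
     (LEAST d. span_over invariant_field ((\<lambda>p. Fract p 1) ` poly_ring_le d) = frac_field)"

end

end

theory Submission
  imports Defs
begin

text \<open>
  Call \<open>(a\<^sub>j, s\<^sub>j)\<close> with \<open>a\<^sub>j \<in> k(V)\<close> and \<open>s\<^sub>j \<in> k[V]\<^bsub>\<le>d\<^esub>\<close> a dual system if
  \<open>\<Sum>\<^sub>j a\<^sub>j (g s\<^sub>j)\<close> is \<open>1\<close> for \<open>g = 1\<close> and \<open>0\<close> for \<open>g \<noteq> 1\<close>. Given one, every \<open>f \<in> k(V)\<close> equals
  \<open>\<Sum>\<^sub>j Tr(f a\<^sub>j) s\<^sub>j\<close>, so the \<open>s\<^sub>j\<close> span \<open>k(V)\<close> over \<open>k(V)\<^sup>G\<close>. If \<open>V\<close> is faithful, some dual system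
  exists: choose a coordinate function \<open>x\<^sub>h\<close> moved by \<open>h\<close> for every \<open>h \<noteq> 1\<close>, and expand
  \<open>\<Prod>\<^sub>h (g x\<^sub>h - h x\<^sub>h) / (x\<^sub>h - h x\<^sub>h)\<close>. Rewriting its polynomials in a spanning set of degree at
  most \<open>d\<close> gives a dual system of degree at most \<open>d\<close>. Finally a dual system for \<open>V\<close> is carried to
  one for \<open>W\<close> by the pullback \<open>k[V] \<rightarrow> k[W]\<close>, which is injective, equivariant and does not
  raise degrees.
\<close>

section \<open>Polynomials of bounded degree in given indeterminates\<close>

text \<open>The indeterminates are a parameter, so one set of closure rules serves both k[V] and
  k[W]; \<open>poly_ring_le d\<close> is the case \<open>X = {..<length bs}\<close>.\<close>

definition bounded_polys :: "nat set \<Rightarrow> nat \<Rightarrow> 'k::field mpoly set" where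
  "bounded_polys X d = {p. indets p \<subseteq> X \<and> total_degree_le p d}"

lemma monom_degree_superset:
  assumes "finite S" "Poly_Mapping.keys m \<subseteq> S"
  shows "(\<Sum>i\<in>Poly_Mapping.keys m. Poly_Mapping.lookup m i) = (\<Sum>i\<in>S. Poly_Mapping.lookup m i)"
  by (rule sum.mono_neutral_left) (use assms in \<open>auto simp: in_keys_iff\<close>)

lemma monom_degree_add:
  fixes m n :: "nat \<Rightarrow>\<^sub>0 nat"
  shows "(\<Sum>i\<in>Poly_Mapping.keys (m + n). Poly_Mapping.lookup (m + n) i) =
    (\<Sum>i\<in>Poly_Mapping.keys m. Poly_Mapping.lookup m i) +
    (\<Sum>i\<in>Poly_Mapping.keys n. Poly_Mapping.lookup n i)"
proof -
  let ?S = "Poly_Mapping.keys m \<union> Poly_Mapping.keys n"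
  have "Poly_Mapping.keys (m + n) \<subseteq> ?S" by (rule keys_add)
  then show ?thesis
    using monom_degree_superset[of ?S m] monom_degree_superset[of ?S n] monom_degree_superset[of ?S "m + n"]
    by (simp add: lookup_add sum.distrib)
qed

lemma bounded_polys_mono: "p \<in> bounded_polys X d \<Longrightarrow> d \<le> e \<Longrightarrow> p \<in> bounded_polys X e"
  by (fastforce simp: bounded_polys_def total_degree_le_def)

lemma bounded_polys_zero: "0 \<in> bounded_polys X d"
  by (simp add: bounded_polys_def indets_def total_degree_le_def)

lemma bounded_polys_Const: "Const c \<in> bounded_polys X 0"
  by (simp add: bounded_polys_def indets_def total_degree_le_def Const_def)

lemma bounded_polys_one: "1 \<in> bounded_polys X 0"
  using bounded_polys_Const[of 1] by (simp add: Const_def)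

lemma bounded_polys_Var: "i \<in> X \<Longrightarrow> Var i \<in> bounded_polys X 1"
  by (simp add: bounded_polys_def indets_def total_degree_le_def Var_def)

lemma bounded_polys_add:
  assumes "p \<in> bounded_polys X d" "q \<in> bounded_polys X d"
  shows "p + q \<in> bounded_polys X d"
proof -
  have "Poly_Mapping.keys (p + q) \<subseteq> Poly_Mapping.keys p \<union> Poly_Mapping.keys q"
    by (rule keys_add)
  then show ?thesis
    using assms unfolding bounded_polys_def indets_def total_degree_le_def by blast
qed

lemma bounded_polys_sum:
  "(\<And>a. a \<in> A \<Longrightarrow> f a \<in> bounded_polys X d) \<Longrightarrow> sum f A \<in> bounded_polys X d"
  by (induction A rule: infinite_finite_induct) (auto intro: bounded_polys_zero bounded_polys_add)

lemma bounded_polys_mult: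
  assumes p: "p \<in> bounded_polys X d" and q: "q \<in> bounded_polys X e"
  shows "p * q \<in> bounded_polys X (d + e)"
proof -
  have "Poly_Mapping.keys m \<subseteq> X \<and>
      (\<Sum>i\<in>Poly_Mapping.keys m. Poly_Mapping.lookup m i) \<le> d + e"
    if m: "m \<in> Poly_Mapping.keys (p * q)" for m
  proof -
    obtain a b where ab: "m = a + b" "a \<in> Poly_Mapping.keys p" "b \<in> Poly_Mapping.keys q"
      using keys_mult[of p q] m by blast
    have "Poly_Mapping.keys a \<subseteq> X" "Poly_Mapping.keys b \<subseteq> X"
      using ab p q unfolding bounded_polys_def indets_def by auto
    then have "Poly_Mapping.keys m \<subseteq> X"
      using keys_add[of a b] ab(1) by blast
    moreover have "(\<Sum>i\<in>Poly_Mapping.keys m. Poly_Mapping.lookup m i) \<le> d + e"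
      unfolding ab(1) monom_degree_add using ab p q
      by (intro add_mono) (auto simp: bounded_polys_def total_degree_le_def)
    ultimately show ?thesis ..
  qed
  then show ?thesis
    unfolding bounded_polys_def indets_def total_degree_le_def by blast
qed

lemma bounded_polys_power: "p \<in> bounded_polys X d \<Longrightarrow> p ^ n \<in> bounded_polys X (n * d)"
  by (induction n) (auto intro: bounded_polys_one bounded_polys_mult)

lemma bounded_polys_prod:
  assumes "finite A" "\<And>a. a \<in> A \<Longrightarrow> f a \<in> bounded_polys X (d a)"
  shows "prod f A \<in> bounded_polys X (sum d A)"
  using assms by (induction A) (auto intro: bounded_polys_one bounded_polys_mult)

lemma bounded_polys_exists: "indets p \<subseteq> X \<Longrightarrow> \<exists>d. p \<in> bounded_polys X d"
proof (intro exI)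
  assume "indets p \<subseteq> X"
  \<comment> \<open>The sum of the degrees of all monomials bounds each of them and, unlike a
    maximum, makes sense for the zero polynomial too.\<close>
  then show "p \<in> bounded_polys X (\<Sum>m\<in>Poly_Mapping.keys p. \<Sum>i\<in>Poly_Mapping.keys m. Poly_Mapping.lookup m i)"
    unfolding bounded_polys_def total_degree_le_def
    by (auto intro!: member_le_sum[where f = "\<lambda>m. \<Sum>i\<in>Poly_Mapping.keys m. Poly_Mapping.lookup m i"])
qed

section \<open>Linear substitutions given by matrices\<close>

text \<open>The common form of the action of a group element and of the pullback along W -> V.
  Equivariance and injectivity of the pullback thereby become identities between matrices.\<close>

definition lin_subst :: "nat \<Rightarrow> (nat \<Rightarrow> nat \<Rightarrow> 'k) \<Rightarrow> 'k::field mpoly \<Rightarrow> 'k mpoly" where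
  "lin_subst n A = poly_eval Const (\<lambda>i. \<Sum>j<n. Const (A i j) * Var j)"

lemma lin_subst_zero: "lin_subst n A 0 = 0"
  and lin_subst_one: "lin_subst n A 1 = 1"
  and lin_subst_add: "lin_subst n A (p + q) = lin_subst n A p + lin_subst n A q"
  and lin_subst_mult: "lin_subst n A (p * q) = lin_subst n A p * lin_subst n A q"
  by (simp_all add: lin_subst_def Const.eval_zero Const.eval_one Const.eval_add Const.eval_mult)

text \<open>Substituting linear forms into linear forms multiplies their matrices; exchanging the
  two summations gives the product of \<open>A\<close> and \<open>B\<close>, in this order.\<close>

lemma lin_subst_compose:
  "lin_subst n B (lin_subst m A p) = lin_subst n (\<lambda>i l. \<Sum>j<m. A i j * B j l) p"
proof -
  have sum_Const: "Const (sum f S) = (\<Sum>a\<in>S. Const (f a))" for f :: "nat \<Rightarrow> 'a" and S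
    by (induction S rule: infinite_finite_induct) (simp_all add: Const.map_zero Const.map_add)
  have "(\<Sum>j<m. Const (A i j) * (\<Sum>l<n. Const (B j l) * Var l))
      = (\<Sum>l<n. Const (\<Sum>j<m. A i j * B j l) * Var l)" for i
    by (simp add: sum_Const sum_distrib_left sum_distrib_right Const.map_mult mult.assoc)
      (rule sum.swap)
  then show ?thesis
    by (simp add: lin_subst_def Const.eval_subst Const.eval_sum Const.eval_mult
        Const.eval_Const Const.eval_Var)
qed

lemma lin_subst_cong:
  assumes "indets p \<subseteq> {..<m}" "\<And>i j. i < m \<Longrightarrow> j < n \<Longrightarrow> A i j = B i j"
  shows "lin_subst n A p = lin_subst n B p"
  unfolding lin_subst_def
  by (rule poly_eval_cong) (use assms in \<open>auto intro!: sum.cong\<close>)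

lemma lin_subst_id:
  assumes "indets p \<subseteq> {..<n}"
  shows "lin_subst n (\<lambda>i j. if i = j then 1 else 0) p = p"
proof -
  have "(\<Sum>j<n. Const (if i = j then 1 else 0) * Var j) = (Var i :: 'a mpoly)" if "i < n" for i
  proof -
    have "(\<Sum>j<n. Const (if i = j then 1 else 0) * Var j) = (\<Sum>j<n. if i = j then Var j else 0 :: 'a mpoly)"
      by (intro sum.cong) (auto simp: Const.map_zero Const.map_one)
    then show ?thesis using that by simp
  qed
  then have "lin_subst n (\<lambda>i j. if i = j then 1 else 0) p = poly_eval Const Var p"
    unfolding lin_subst_def using assms by (intro poly_eval_cong) auto
  then show ?thesis by (simp add: poly_eval_Var)
qed

text \<open>Each indeterminate goes to a form of degree at most 1, so a monomial of degree e goes to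
  a product of e such forms.\<close>

lemma lin_subst_bounded:
  assumes "total_degree_le p d"
  shows "lin_subst n A p \<in> bounded_polys {..<n} d"
  unfolding lin_subst_def poly_eval_def
proof (intro bounded_polys_sum)
  fix m assume m: "m \<in> Poly_Mapping.keys p"
  let ?\<sigma> = "\<lambda>i. \<Sum>j<n. Const (A i j) * Var j"
  have "Const (A i j) * Var j \<in> bounded_polys {..<n} 1" if "j < n" for i j
    using bounded_polys_mult[OF bounded_polys_Const[of "A i j"] bounded_polys_Var[of j "{..<n}"]] that
    by simp
  then have \<sigma>: "?\<sigma> i \<in> bounded_polys {..<n} 1" for i
    by (intro bounded_polys_sum) simp
  have "?\<sigma> i ^ k \<in> bounded_polys {..<n} k" for i k
    using bounded_polys_power[OF \<sigma>] by (simp only: mult_1_right)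
  then have "monom_eval ?\<sigma> m \<in> bounded_polys {..<n} (\<Sum>i\<in>Poly_Mapping.keys m. Poly_Mapping.lookup m i)"
    unfolding monom_eval_def by (intro bounded_polys_prod) simp_all
  then have "monom_eval ?\<sigma> m \<in> bounded_polys {..<n} d"
    by (rule bounded_polys_mono) (use assms m in \<open>simp add: total_degree_le_def\<close>)
  from bounded_polys_mult[OF bounded_polys_Const this]
  show "Const (Poly_Mapping.lookup p m) * monom_eval ?\<sigma> m \<in> bounded_polys {..<n} d"
    by simp
qed

section \<open>Embedding a domain in its fraction field, and spans over subfields\<close>

definition emb :: "'a::idom \<Rightarrow> 'a fract" where
  "emb p = Fract p 1"

lemma emb_zero [simp]: "emb 0 = 0"
  and emb_one [simp]: "emb 1 = 1"
  and emb_add: "emb (p + q) = emb p + emb q"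
  and emb_mult: "emb (p * q) = emb p * emb q"
  and emb_eq_iff [simp]: "emb p = emb q \<longleftrightarrow> p = q"
  by (simp_all add: emb_def fract_collapse eq_fract)

lemma emb_eq_0_iff [simp]: "emb p = 0 \<longleftrightarrow> p = 0"
  using emb_eq_iff[of p 0] by (simp del: emb_eq_iff)

lemma Fract_eq_emb: "Fract p q = emb p / emb q"
  by (simp add: emb_def)

text \<open>An element of \<open>span_over\<close> has one coefficient per vector, and the two
  supports may overlap. Both families are therefore extended by 0 to the union and added, which uses
  the closure conditions on \<open>K\<close>.\<close>

lemma span_over_add:
  assumes "0 \<in> K" "\<And>a b. a \<in> K \<Longrightarrow> b \<in> K \<Longrightarrow> a + b \<in> K"
    and "x \<in> span_over K S" "y \<in> span_over K S"
  shows "x + y \<in> span_over K S"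
proof -
  obtain T c where T: "finite T" "T \<subseteq> S" "c ` T \<subseteq> K" "x = (\<Sum>s\<in>T. c s * s)"
    using assms(3) unfolding span_over_def by blast
  obtain U d where U: "finite U" "U \<subseteq> S" "d ` U \<subseteq> K" "y = (\<Sum>s\<in>U. d s * s)"
    using assms(4) unfolding span_over_def by blast
  define e where "e s = (if s \<in> T then c s else 0) + (if s \<in> U then d s else 0)" for s
  have "x = (\<Sum>s\<in>T \<union> U. (if s \<in> T then c s else 0) * s)"
    unfolding T(4) by (rule sum.mono_neutral_cong_left) (use T U in auto)
  moreover have "y = (\<Sum>s\<in>T \<union> U. (if s \<in> U then d s else 0) * s)"
    unfolding U(4) by (rule sum.mono_neutral_cong_left) (use T U in auto)
  ultimately have "x + y = (\<Sum>s\<in>T \<union> U. e s * s)"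
    by (simp add: e_def distrib_right sum.distrib)
  moreover have "e ` (T \<union> U) \<subseteq> K"
    using T(3) U(3) assms(1,2) unfolding e_def by (auto simp: image_subset_iff)
  ultimately show ?thesis
    unfolding span_over_def using T(1,2) U(1,2) by blast
qed

lemma span_over_zero: "0 \<in> span_over K S"
  unfolding span_over_def by (rule CollectI, rule exI[of _ "{}"]) auto

lemma span_over_scaled: "c \<in> K \<Longrightarrow> s \<in> S \<Longrightarrow> c * s \<in> span_over K S"
  unfolding span_over_def by (rule CollectI, rule exI[of _ "{s}"], rule exI[of _ "\<lambda>_. c"]) auto

text \<open>Evaluating both sides at the \<open>j\<close>-th unit vector isolates the
  coefficient.\<close>

lemma linear_form_eq_Var_coeff:
  assumes "(\<Sum>j<n. Const (c j) * Var j) = (Var i :: 'k::field mpoly)" "j < n"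
  shows "c j = (if i = j then 1 else 0)"
proof -
  have "poly_eval (\<lambda>c. c) (\<lambda>l. if l = j then 1 else 0) (\<Sum>j<n. Const (c j) * Var j) = (\<Sum>l<n. c l * (if l = j then 1 else 0))"
    by (simp add: id_hom.eval_sum id_hom.eval_mult id_hom.eval_Const id_hom.eval_Var)
  also have "\<dots> = (\<Sum>l<n. if l = j then c l else 0)"
    by (intro sum.cong) auto
  also have "\<dots> = c j" using assms(2) by simp
  finally show ?thesis by (simp add: assms(1) id_hom.eval_Var)
qed

section \<open>The ring k[V], the field k(V), and the action of G on both\<close>

context fin_dim_rep
begin

lemma poly_ring_le_eq: "poly_ring_le d = bounded_polys {..<length bs} d"
  by (auto simp: poly_ring_le_def poly_ring_def bounded_polys_def)

lemma poly_ring_eq: "poly_ring = (\<Union>d. bounded_polys {..<length bs} d)"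
  using bounded_polys_exists by (auto simp: poly_ring_def) (auto simp: bounded_polys_def)

lemma poly_ring_zero: "0 \<in> poly_ring"
  and poly_ring_one: "1 \<in> poly_ring"
  using bounded_polys_zero bounded_polys_one unfolding poly_ring_eq by blast+

lemma poly_ring_mult: "p \<in> poly_ring \<Longrightarrow> q \<in> poly_ring \<Longrightarrow> p * q \<in> poly_ring"
  unfolding poly_ring_eq using bounded_polys_mult by blast

lemma poly_ring_add:
  assumes "p \<in> poly_ring" "q \<in> poly_ring"
  shows "p + q \<in> poly_ring"
proof -
  obtain d e where "p \<in> bounded_polys {..<length bs} d" "q \<in> bounded_polys {..<length bs} e"
    using assms unfolding poly_ring_eq by blast
  then have "p + q \<in> bounded_polys {..<length bs} (max d e)"
    by (meson bounded_polys_add bounded_polys_mono max.cobounded1 max.cobounded2)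
  then show ?thesis unfolding poly_ring_eq by blast
qed

lemma poly_ring_uminus: "p \<in> poly_ring \<Longrightarrow> - p \<in> poly_ring"
  by (simp add: poly_ring_def indets_def)

lemma poly_ring_prod: "(\<And>a. a \<in> A \<Longrightarrow> f a \<in> poly_ring) \<Longrightarrow> prod f A \<in> poly_ring"
  by (induction A rule: infinite_finite_induct) (auto intro: poly_ring_one poly_ring_mult)

lemma poly_act_lin_subst:
  "poly_act g = lin_subst (length bs) (\<lambda>i j. coord i (\<rho> (inv\<^bsub>G\<^esub> g) (bs ! j)))"
  by (simp add: poly_act_def lin_subst_def)

lemma poly_act_in_poly_ring: "p \<in> poly_ring \<Longrightarrow> poly_act g p \<in> poly_ring"
  unfolding poly_ring_eq poly_act_lin_subst
  using lin_subst_bounded unfolding bounded_polys_def by blast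

lemma frac_field_eq: "frac_field = {emb p / emb q |p q. p \<in> poly_ring \<and> q \<in> poly_ring \<and> q \<noteq> 0}"
  by (simp add: frac_field_def Fract_eq_emb)

lemma frac_fieldE:
  assumes "f \<in> frac_field"
  obtains p q where "p \<in> poly_ring" "q \<in> poly_ring" "q \<noteq> 0" "f = emb p / emb q"
  using assms unfolding frac_field_eq by blast

lemma frac_fieldI: "p \<in> poly_ring \<Longrightarrow> q \<in> poly_ring \<Longrightarrow> q \<noteq> 0 \<Longrightarrow> emb p / emb q \<in> frac_field"
  unfolding frac_field_eq by blast

lemma emb_in_frac_field: "p \<in> poly_ring \<Longrightarrow> emb p \<in> frac_field"
  using frac_fieldI[OF _ poly_ring_one] by simp

lemma frac_field_zero: "0 \<in> frac_field"
  using emb_in_frac_field[OF poly_ring_zero] by simp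

text \<open>\<open>frac_act\<close> is accessible only through numerators and denominators in
  \<open>poly_ring\<close>. Membership and additivity use the same choice of these, hence the joint
  statement.\<close>

lemma frac_field_add_act:
  assumes "g \<in> carrier G" "f \<in> frac_field" "f' \<in> frac_field"
  shows "f + f' \<in> frac_field \<and> frac_act g (f + f') = frac_act g f + frac_act g f'"
proof -
  obtain p q where f: "p \<in> poly_ring" "q \<in> poly_ring" "q \<noteq> 0" "f = Fract p q"
    using assms(2) unfolding frac_field_def by blast
  obtain p' q' where f': "p' \<in> poly_ring" "q' \<in> poly_ring" "q' \<noteq> 0" "f' = Fract p' q'"
    using assms(3) unfolding frac_field_def by blast
  have r: "p * q' + p' * q \<in> poly_ring" "q * q' \<in> poly_ring"
    using f f' by (auto intro: poly_ring_add poly_ring_mult)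
  moreover have "frac_act g (f + f') = frac_act g f + frac_act g f'"
    using f f' r assms(1)
    by (simp add: frac_act_Fract poly_act_nonzero)
      (simp add: poly_act_lin_subst lin_subst_add lin_subst_mult)
  ultimately show ?thesis
    using f f' unfolding frac_field_def by fastforce
qed

lemma frac_field_mult_act:
  assumes "g \<in> carrier G" "f \<in> frac_field" "f' \<in> frac_field"
  shows "f * f' \<in> frac_field \<and> frac_act g (f * f') = frac_act g f * frac_act g f'"
proof -
  obtain p q where f: "p \<in> poly_ring" "q \<in> poly_ring" "q \<noteq> 0" "f = Fract p q"
    using assms(2) unfolding frac_field_def by blast
  obtain p' q' where f': "p' \<in> poly_ring" "q' \<in> poly_ring" "q' \<noteq> 0" "f' = Fract p' q'"
    using assms(3) unfolding frac_field_def by blast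
  have r: "p * p' \<in> poly_ring" "q * q' \<in> poly_ring"
    using f f' by (auto intro: poly_ring_mult)
  moreover have "frac_act g (f * f') = frac_act g f * frac_act g f'"
    using f f' r assms(1)
    by (simp add: frac_act_Fract poly_act_mult)
  ultimately show ?thesis
    using f f' unfolding frac_field_def by fastforce
qed

lemma G_group: "group G"
  using group_hom by (simp add: group_hom_def)

lemma one_carrier: "\<one>\<^bsub>G\<^esub> \<in> carrier G"
  using G_group by (simp add: group_def monoid.one_closed)

text \<open>Membership does not mention \<open>g\<close>, so it is extracted by taking
  \<open>g\<close> to be the unit.\<close>

lemmas frac_field_add = frac_field_add_act[OF one_carrier, THEN conjunct1]
lemmas frac_field_mult = frac_field_mult_act[OF one_carrier, THEN conjunct1]
lemmas frac_act_add = frac_field_add_act[THEN conjunct2]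
lemmas frac_act_mult = frac_field_mult_act[THEN conjunct2]

lemma frac_field_sum: "(\<And>a. a \<in> A \<Longrightarrow> f a \<in> frac_field) \<Longrightarrow> sum f A \<in> frac_field"
  by (induction A rule: infinite_finite_induct) (auto intro: frac_field_zero frac_field_add)

lemma frac_act_emb: "g \<in> carrier G \<Longrightarrow> p \<in> poly_ring \<Longrightarrow> frac_act g (emb p) = emb (poly_act g p)"
  using frac_act_Fract[of g p 1]
  by (simp add: emb_def poly_ring_one) (simp add: poly_act_lin_subst lin_subst_one)

lemma frac_act_zero: "g \<in> carrier G \<Longrightarrow> frac_act g 0 = 0"
  using frac_act_emb[OF _ poly_ring_zero] by (simp add: poly_act_lin_subst lin_subst_zero)

lemma frac_act_one: "g \<in> carrier G \<Longrightarrow> frac_act g 1 = 1"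
  using frac_act_emb[OF _ poly_ring_one] by (simp add: poly_act_lin_subst lin_subst_one)

lemma frac_act_sum:
  assumes "g \<in> carrier G" "\<And>a. a \<in> A \<Longrightarrow> f a \<in> frac_field"
  shows "frac_act g (sum f A) = (\<Sum>a\<in>A. frac_act g (f a))"
  using assms(2)
  by (induction A rule: infinite_finite_induct)
    (auto simp: frac_act_zero frac_act_add frac_field_sum assms(1))

lemma frac_act_in_frac_field: "g \<in> carrier G \<Longrightarrow> f \<in> frac_field \<Longrightarrow> frac_act g f \<in> frac_field"
  unfolding frac_field_def
  by (auto simp: frac_act_Fract) (metis poly_act_in_poly_ring poly_act_nonzero)

lemma frac_act_compose:
  assumes "g \<in> carrier G" "h \<in> carrier G" "f \<in> frac_field"
  shows "frac_act g (frac_act h f) = frac_act (g \<otimes>\<^bsub>G\<^esub> h) f"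
  using assms monoid.m_closed[OF group.is_monoid[OF G_group], of g h]
  unfolding frac_field_def
  by (auto simp: frac_act_Fract poly_act_in_poly_ring poly_act_nonzero poly_act_compose)

lemma frac_act_id: "f \<in> frac_field \<Longrightarrow> frac_act \<one>\<^bsub>G\<^esub> f = f"
  using group.is_monoid[OF G_group]
  unfolding frac_field_def by (auto simp: frac_act_Fract poly_act_one)

lemma invariant_zero: "0 \<in> invariant_field"
  by (simp add: invariant_field_def frac_field_zero frac_act_zero)

lemma invariant_add: "a \<in> invariant_field \<Longrightarrow> b \<in> invariant_field \<Longrightarrow> a + b \<in> invariant_field"
  by (simp add: invariant_field_def frac_field_add frac_act_add)

text \<open>Acting by h reindexes the sum along left multiplication by h, a bijection of the
  group.\<close>

lemma trace_invariant:
  assumes "f \<in> frac_field"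
  shows "(\<Sum>g\<in>carrier G. frac_act g f) \<in> invariant_field"
  unfolding invariant_field_def
proof (intro CollectI conjI ballI)
  interpret G: group G by (rule G_group)
  show "(\<Sum>g\<in>carrier G. frac_act g f) \<in> frac_field"
    using assms by (intro frac_field_sum frac_act_in_frac_field)
  fix h assume h: "h \<in> carrier G"
  have "frac_act h (\<Sum>g\<in>carrier G. frac_act g f) = (\<Sum>g\<in>carrier G. frac_act (h \<otimes>\<^bsub>G\<^esub> g) f)"
    using assms h by (simp add: frac_act_sum frac_act_in_frac_field frac_act_compose)
  also have "\<dots> = (\<Sum>g\<in>carrier G. frac_act g f)"
    by (rule sum.reindex_bij_betw)
      (use h in \<open>auto simp: bij_betw_def G.inj_on_cmult G.surj_const_mult\<close>)
  finally show "frac_act h (\<Sum>g\<in>carrier G. frac_act g f) = (\<Sum>g\<in>carrier G. frac_act g f)" .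
qed

section \<open>Linear combinations of orbit maps\<close>

text \<open>The k(V)-span of the maps g -> g s with s of degree at most \<open>d\<close>, inside the
  functions from G to k(V); the coefficients are not moved by g. Lists let two presentations be
  added by concatenation, without merging coefficients of a repeated s. Values off the carrier are
  left free.\<close>

definition orbit_functions :: "nat \<Rightarrow> ('g \<Rightarrow> 'k mpoly fract) set" where
  "orbit_functions d = {h. \<exists>ps. set ps \<subseteq> frac_field \<times> poly_ring_le d \<and>
     (\<forall>g\<in>carrier G. h g = (\<Sum>(a, s)\<leftarrow>ps. a * emb (poly_act g s)))}"

lemma orbit_functionsI:
  assumes "set ps \<subseteq> frac_field \<times> poly_ring_le d"
    and "\<And>g. g \<in> carrier G \<Longrightarrow> h g = (\<Sum>(a, s)\<leftarrow>ps. a * emb (poly_act g s))"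
  shows "h \<in> orbit_functions d"
  using assms unfolding orbit_functions_def by blast

lemma orbit_functionsE:
  assumes "h \<in> orbit_functions d"
  obtains ps where "set ps \<subseteq> frac_field \<times> poly_ring_le d"
    and "\<And>g. g \<in> carrier G \<Longrightarrow> h g = (\<Sum>(a, s)\<leftarrow>ps. a * emb (poly_act g s))"
  using assms unfolding orbit_functions_def by blast

lemma orbit_functions_cong:
  "h \<in> orbit_functions d \<Longrightarrow> (\<And>g. g \<in> carrier G \<Longrightarrow> h' g = h g) \<Longrightarrow> h' \<in> orbit_functions d"
  unfolding orbit_functions_def by auto

lemma orbit_functions_zero: "(\<lambda>g. 0) \<in> orbit_functions d"
  by (rule orbit_functionsI[where ps = "[]"]) auto

lemma orbit_functions_add:
  assumes "h \<in> orbit_functions d" "h' \<in> orbit_functions d"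
  shows "(\<lambda>g. h g + h' g) \<in> orbit_functions d"
proof -
  obtain ps where ps: "set ps \<subseteq> frac_field \<times> poly_ring_le d"
    "\<And>g. g \<in> carrier G \<Longrightarrow> h g = (\<Sum>(a, s)\<leftarrow>ps. a * emb (poly_act g s))"
    using assms(1) by (rule orbit_functionsE) blast
  obtain qs where qs: "set qs \<subseteq> frac_field \<times> poly_ring_le d"
    "\<And>g. g \<in> carrier G \<Longrightarrow> h' g = (\<Sum>(a, s)\<leftarrow>qs. a * emb (poly_act g s))"
    using assms(2) by (rule orbit_functionsE) blast
  show ?thesis
    by (rule orbit_functionsI[where ps = "ps @ qs"]) (use ps qs in auto)
qed

lemma orbit_functions_sum:
  "(\<And>t. t \<in> T \<Longrightarrow> h t \<in> orbit_functions d) \<Longrightarrow> (\<lambda>g. \<Sum>t\<in>T. h t g) \<in> orbit_functions d"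
  by (induction T rule: infinite_finite_induct)
    (auto intro: orbit_functions_zero orbit_functions_add)

lemma orbit_functions_scale:
  assumes "h \<in> orbit_functions d" "c \<in> frac_field"
  shows "(\<lambda>g. c * h g) \<in> orbit_functions d"
proof -
  obtain ps where ps: "set ps \<subseteq> frac_field \<times> poly_ring_le d"
    "\<And>g. g \<in> carrier G \<Longrightarrow> h g = (\<Sum>(a, s)\<leftarrow>ps. a * emb (poly_act g s))"
    using assms(1) by (rule orbit_functionsE) blast
  show ?thesis
    by (rule orbit_functionsI[where ps = "map (\<lambda>(a, s). (c * a, s)) ps"])
      (use ps assms(2) in \<open>auto simp: o_def case_prod_unfold mult.assoc sum_list_const_mult
        intro!: frac_field_mult\<close>)
qed

lemma orbit_functions_poly_act:
  "s \<in> poly_ring_le d \<Longrightarrow> (\<lambda>g. emb (poly_act g s)) \<in> orbit_functions d"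
  by (rule orbit_functionsI[where ps = "[(1, s)]"])
    (use emb_in_frac_field[OF poly_ring_one] in auto)

text \<open>Since (g x)(g s) = g (x s), the factor is absorbed by replacing each s with x s, at the
  cost of the degree of x.\<close>

lemma orbit_functions_mult_poly_act:
  assumes "h \<in> orbit_functions d" "x \<in> poly_ring_le e"
  shows "(\<lambda>g. emb (poly_act g x) * h g) \<in> orbit_functions (e + d)"
proof -
  obtain ps where ps: "set ps \<subseteq> frac_field \<times> poly_ring_le d"
    "\<And>g. g \<in> carrier G \<Longrightarrow> h g = (\<Sum>(a, s)\<leftarrow>ps. a * emb (poly_act g s))"
    using assms(1) by (rule orbit_functionsE) blast
  show ?thesis
    by (rule orbit_functionsI[where ps = "map (\<lambda>(a, s). (a, x * s)) ps"])
      (use ps assms(2) in \<open>auto simp: o_def case_prod_unfold mult.left_commute poly_act_mult emb_mult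
        poly_ring_le_eq simp flip: sum_list_const_mult intro!: bounded_polys_mult\<close>)
qed

lemma orbit_functions_mono:
  assumes "h \<in> orbit_functions d" "d \<le> e"
  shows "h \<in> orbit_functions e"
proof -
  have "poly_ring_le d \<subseteq> poly_ring_le e"
    using bounded_polys_mono[OF _ assms(2)] by (auto simp: poly_ring_le_eq)
  then show ?thesis using assms(1) unfolding orbit_functions_def by fast
qed

text \<open>Prepares the transfer to W: the pullback is defined on polynomials, so the presentation
  has to become a polynomial identity. The denominator \<open>q\<close> is the same for all
  \<open>g\<close>.\<close>

lemma orbit_functions_clear_denominators:
  assumes "h \<in> orbit_functions d"
  obtains q ps where "q \<in> poly_ring" "q \<noteq> 0" "set ps \<subseteq> poly_ring \<times> poly_ring_le d"
    and "\<And>g. g \<in> carrier G \<Longrightarrow> emb q * h g = emb (\<Sum>(p, s)\<leftarrow>ps. p * poly_act g s)"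
proof -
  have "\<exists>q qs. q \<in> poly_ring \<and> q \<noteq> 0 \<and> set qs \<subseteq> poly_ring \<times> poly_ring_le d \<and>
      (\<forall>g. emb q * (\<Sum>(a, s)\<leftarrow>ps. a * emb (poly_act g s)) = emb (\<Sum>(p, s)\<leftarrow>qs. p * poly_act g s))"
    if "set ps \<subseteq> frac_field \<times> poly_ring_le d" for ps
    using that
  proof (induction ps)
    case Nil
    show ?case
      by (rule exI[of _ 1], rule exI[of _ "[]"]) (simp add: poly_ring_one)
  next
    case (Cons as ps)
    obtain a s where as: "as = (a, s)" by fastforce
    obtain q qs where IH: "q \<in> poly_ring" "q \<noteq> 0" "set qs \<subseteq> poly_ring \<times> poly_ring_le d"
      "\<And>g. emb q * (\<Sum>(a, s)\<leftarrow>ps. a * emb (poly_act g s)) = emb (\<Sum>(p, s)\<leftarrow>qs. p * poly_act g s)"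
      using Cons by auto
    have "a \<in> frac_field" and s: "s \<in> poly_ring_le d" using Cons.prems as by auto
    then obtain b r where br: "b \<in> poly_ring" "r \<in> poly_ring" "r \<noteq> 0" "a = emb b / emb r"
      by (auto elim: frac_fieldE)
    \<comment> \<open>Over the new common denominator \<open>r * q\<close>, the head coefficient b/r
      has numerator \<open>q * b\<close>, and the earlier numerators are multiplied by
      \<open>r\<close>.\<close>
    let ?qs = "(q * b, s) # map (\<lambda>(p, s). (r * p, s)) qs"
    have "emb (r * q) * (\<Sum>(a, s)\<leftarrow>as # ps. a * emb (poly_act g s))
        = emb (\<Sum>(p, s)\<leftarrow>?qs. p * poly_act g s)" for g
    proof -
      have "emb (r * q) * (\<Sum>(a, s)\<leftarrow>as # ps. a * emb (poly_act g s))
         = emb q * emb b * emb (poly_act g s)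
           + emb r * (emb q * (\<Sum>(a, s)\<leftarrow>ps. a * emb (poly_act g s)))"
        using br by (simp add: as emb_mult field_simps)
      also have "\<dots> = emb (\<Sum>(p, s)\<leftarrow>?qs. p * poly_act g s)"
        unfolding IH(4)
        by (simp add: emb_add emb_mult o_def case_prod_unfold mult.assoc sum_list_const_mult)
      finally show ?thesis .
    qed
    moreover have "set ?qs \<subseteq> poly_ring \<times> poly_ring_le d"
      using IH(1,3) br s by (auto intro: poly_ring_mult)
    moreover have "r * q \<in> poly_ring" "r * q \<noteq> 0"
      using IH(1,2) br by (auto intro: poly_ring_mult)
    ultimately show ?case by blast
  qed
  note clear = this
  obtain ps where ps: "set ps \<subseteq> frac_field \<times> poly_ring_le d"
    and h: "\<And>g. g \<in> carrier G \<Longrightarrow> h g = (\<Sum>(a, s)\<leftarrow>ps. a * emb (poly_act g s))"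
    using assms by (rule orbit_functionsE) blast
  obtain q qs where "q \<in> poly_ring" "q \<noteq> 0" "set qs \<subseteq> poly_ring \<times> poly_ring_le d"
    and eq: "\<And>g. emb q * (\<Sum>(a, s)\<leftarrow>ps. a * emb (poly_act g s)) = emb (\<Sum>(p, s)\<leftarrow>qs. p * poly_act g s)"
    using clear[OF ps] by blast
  then show thesis
    using that h by simp
qed

section \<open>Dual systems and spanning sets\<close>

text \<open>Its membership in \<open>orbit_functions d\<close> says exactly that a dual system with
  polynomials of degree at most d exists.\<close>

definition delta_one :: "'g \<Rightarrow> 'k mpoly fract" where
  "delta_one g = (if g = \<one>\<^bsub>G\<^esub> then 1 else 0)"

lemma span_over_subset: "span_over invariant_field ((\<lambda>p. Fract p 1) ` poly_ring_le d) \<subseteq> frac_field"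
proof
  fix x assume "x \<in> span_over invariant_field ((\<lambda>p. Fract p 1) ` poly_ring_le d)"
  then obtain T c where T: "T \<subseteq> emb ` poly_ring_le d" "c ` T \<subseteq> invariant_field" "x = (\<Sum>s\<in>T. c s * s)"
    unfolding span_over_def emb_def by blast
  have "c s * s \<in> frac_field" if "s \<in> T" for s
  proof -
    have "c s \<in> frac_field" using T(2) that by (auto simp: invariant_field_def)
    moreover have "s \<in> frac_field"
      using T(1) that by (auto simp: poly_ring_le_def intro: emb_in_frac_field)
    ultimately show ?thesis by (rule frac_field_mult)
  qed
  then show "x \<in> frac_field" unfolding T(3) by (rule frac_field_sum)
qed

text \<open>Writing s_j = g (g^-1 s_j) and exchanging sums turns the sum of Tr(f a_j) s_j into the
  sum over g of (g f) times g applied to the sum of a_j (g^-1 s_j). The inner sum is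
  \<open>delta_one\<close> at g^-1, so only the term f at the unit survives.\<close>

lemma spans_if_delta_one:
  assumes fin: "finite (carrier G)" and "delta_one \<in> orbit_functions d"
  shows "span_over invariant_field ((\<lambda>p. Fract p 1) ` poly_ring_le d) = frac_field"
proof (intro equalityI span_over_subset subsetI)
  interpret G: group G by (rule G_group)
  let ?span = "span_over invariant_field (emb ` poly_ring_le d)"
  obtain ps where ps: "set ps \<subseteq> frac_field \<times> poly_ring_le d"
    and delta: "\<And>g. g \<in> carrier G \<Longrightarrow> delta_one g = (\<Sum>(a, s)\<leftarrow>ps. a * emb (poly_act g s))"
    using assms(2) by (rule orbit_functionsE) blast
  fix f assume f: "f \<in> frac_field"
  define tr where "tr a = (\<Sum>g\<in>carrier G. frac_act g (f * a))" for a
  \<comment> \<open>The induction carries three claims: the combination lies in the span, it equals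
    the rearranged double sum, and the inner sums lie in k(V). The last one is what allows
    \<open>frac_act\<close> to be distributed over them.\<close>
  have *: "(\<Sum>(a, s)\<leftarrow>ps. tr a * emb s) \<in> ?span \<and>
      (\<Sum>(a, s)\<leftarrow>ps. tr a * emb s) =
        (\<Sum>g\<in>carrier G. frac_act g f * frac_act g (\<Sum>(a, s)\<leftarrow>ps. a * emb (poly_act (inv\<^bsub>G\<^esub> g) s))) \<and>
      (\<forall>g. (\<Sum>(a, s)\<leftarrow>ps. a * emb (poly_act g s)) \<in> frac_field)"
    using ps
  proof (induction ps)
    case Nil
    show ?case by (auto simp: span_over_zero frac_act_zero frac_field_zero)
  next
    case (Cons as ps)
    obtain a s where as: "as = (a, s)" by fastforce
    have a: "a \<in> frac_field" and s: "s \<in> poly_ring_le d" "s \<in> poly_ring"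
      using Cons.prems as by (auto simp: poly_ring_le_def)
    let ?R = "\<lambda>g. \<Sum>(a, s)\<leftarrow>ps. a * emb (poly_act g s)"
    have IH: "(\<Sum>(a, s)\<leftarrow>ps. tr a * emb s) \<in> ?span"
        "(\<Sum>(a, s)\<leftarrow>ps. tr a * emb s) = (\<Sum>g\<in>carrier G. frac_act g f * frac_act g (?R (inv\<^bsub>G\<^esub> g)))"
        "\<And>g. ?R g \<in> frac_field"
      using Cons by auto
    have fa: "f * a \<in> frac_field" using f a by (rule frac_field_mult)
    have ag: "a * emb (poly_act g s) \<in> frac_field" for g
      using a s by (auto intro: frac_field_mult emb_in_frac_field poly_act_in_poly_ring)
    have "tr a * emb s \<in> ?span"
      using s(1) trace_invariant[OF fa] unfolding tr_def by (intro span_over_scaled) auto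
    then have 1: "(\<Sum>(a, s)\<leftarrow>as # ps. tr a * emb s) \<in> ?span"
      using IH(1) by (simp add: as span_over_add invariant_zero invariant_add)
    have "frac_act g (f * a) * emb s = frac_act g f * frac_act g (a * emb (poly_act (inv\<^bsub>G\<^esub> g) s))"
      if g: "g \<in> carrier G" for g
      using f a s g
      by (simp add: frac_act_mult frac_act_emb emb_in_frac_field poly_act_in_poly_ring
          poly_act_compose poly_act_one mult.assoc)
    then have "tr a * emb s = (\<Sum>g\<in>carrier G. frac_act g f * frac_act g (a * emb (poly_act (inv\<^bsub>G\<^esub> g) s)))"
      unfolding tr_def by (simp add: sum_distrib_right)
    then have "(\<Sum>(a, s)\<leftarrow>as # ps. tr a * emb s) = (\<Sum>g\<in>carrier G. frac_act g f *
        (frac_act g (a * emb (poly_act (inv\<^bsub>G\<^esub> g) s)) + frac_act g (?R (inv\<^bsub>G\<^esub> g))))"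
      by (simp add: as IH(2) distrib_left sum.distrib)
    also have "\<dots> = (\<Sum>g\<in>carrier G. frac_act g f * frac_act g (a * emb (poly_act (inv\<^bsub>G\<^esub> g) s) + ?R (inv\<^bsub>G\<^esub> g)))"
      using ag IH(3) by (simp add: frac_act_add)
    finally show ?case
      using 1 ag IH(3) by (simp add: as frac_field_add)
  qed
  have "(\<Sum>g\<in>carrier G. frac_act g f * frac_act g (\<Sum>(a, s)\<leftarrow>ps. a * emb (poly_act (inv\<^bsub>G\<^esub> g) s)))
      = (\<Sum>g\<in>carrier G. if g = \<one>\<^bsub>G\<^esub> then f else 0)"
  proof (rule sum.cong[OF refl])
    fix g assume g: "g \<in> carrier G"
    then have "(\<Sum>(a, s)\<leftarrow>ps. a * emb (poly_act (inv\<^bsub>G\<^esub> g) s)) = (if g = \<one>\<^bsub>G\<^esub> then 1 else 0)"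
      using delta[of "inv\<^bsub>G\<^esub> g"] by (simp add: delta_one_def)
    then show "frac_act g f * frac_act g (\<Sum>(a, s)\<leftarrow>ps. a * emb (poly_act (inv\<^bsub>G\<^esub> g) s))
        = (if g = \<one>\<^bsub>G\<^esub> then f else 0)"
      using g f by (simp add: frac_act_zero frac_act_one frac_act_id)
  qed
  also have "\<dots> = f" using fin by simp
  finally show "f \<in> span_over invariant_field ((\<lambda>p. Fract p 1) ` poly_ring_le d)"
    using * unfolding emb_def by metis
qed

text \<open>If s is the sum of c_t t with invariant c_t and t of degree at most d, then g s is the
  sum of c_t (g t), with coefficients independent of g. Hence the orbit map of every polynomial, of
  whatever degree, lies in \<open>orbit_functions d\<close>, and k(V)-linearity does the
  rest.\<close>

lemma orbit_functions_if_spans: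
  assumes "span_over invariant_field ((\<lambda>p. Fract p 1) ` poly_ring_le d) = frac_field"
    and "h \<in> orbit_functions e"
  shows "h \<in> orbit_functions d"
proof -
  have poly: "(\<lambda>g. emb (poly_act g s)) \<in> orbit_functions d" if s: "s \<in> poly_ring" for s
  proof -
    have "emb s \<in> span_over invariant_field (emb ` poly_ring_le d)"
      using assms(1) emb_in_frac_field[OF s] unfolding emb_def by simp
    then obtain T c where T: "finite T" "T \<subseteq> emb ` poly_ring_le d" "c ` T \<subseteq> invariant_field"
      and eq: "emb s = (\<Sum>t\<in>T. c t * t)"
      unfolding span_over_def by blast
    have c: "c t \<in> frac_field" "\<And>g. g \<in> carrier G \<Longrightarrow> frac_act g (c t) = c t" if "t \<in> T" for t
      using T(3) that by (auto simp: invariant_field_def)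
    have t: "t \<in> frac_field" "(\<lambda>g. frac_act g t) \<in> orbit_functions d" if tT: "t \<in> T" for t
    proof -
      obtain p where p: "p \<in> poly_ring_le d" "t = emb p" using T(2) tT by blast
      then have "p \<in> poly_ring" by (simp add: poly_ring_le_def)
      with p show "t \<in> frac_field" "(\<lambda>g. frac_act g t) \<in> orbit_functions d"
        by (auto simp: frac_act_emb intro: emb_in_frac_field
            orbit_functions_cong[OF orbit_functions_poly_act])
    qed
    have "(\<lambda>g. \<Sum>t\<in>T. c t * frac_act g t) \<in> orbit_functions d"
      using c(1) t(2) by (intro orbit_functions_sum orbit_functions_scale) auto
    moreover have "emb (poly_act g s) = (\<Sum>t\<in>T. c t * frac_act g t)" if g: "g \<in> carrier G" for g
    proof -
      have "emb (poly_act g s) = frac_act g (\<Sum>t\<in>T. c t * t)"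
        using s g by (simp add: frac_act_emb flip: eq)
      also have "\<dots> = (\<Sum>t\<in>T. c t * frac_act g t)"
        using c t g by (simp add: frac_act_sum frac_field_mult frac_act_mult)
      finally show ?thesis .
    qed
    ultimately show ?thesis by (rule orbit_functions_cong)
  qed
  obtain ps where ps: "set ps \<subseteq> frac_field \<times> poly_ring_le e"
    and h: "\<And>g. g \<in> carrier G \<Longrightarrow> h g = (\<Sum>(a, s)\<leftarrow>ps. a * emb (poly_act g s))"
    using assms(2) by (rule orbit_functionsE) blast
  have "(\<lambda>g. \<Sum>(a, s)\<leftarrow>ps. a * emb (poly_act g s)) \<in> orbit_functions d"
    using ps
  proof (induction ps)
    case Nil
    show ?case by (simp add: orbit_functions_zero)
  next
    case (Cons as ps)
    then show ?case
      by (cases as) (auto simp: poly_ring_le_def intro!: orbit_functions_add orbit_functions_scale poly)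
  qed
  then show ?thesis by (rule orbit_functions_cong) (rule h)
qed

section \<open>Existence of a dual system for a faithful representation\<close>

text \<open>If h fixed every coordinate function, the matrix of its inverse would be the identity,
  so the inverse would act as the unit does, against faithfulness.\<close>

lemma moves_coordinate:
  assumes "faithful_action G UNIV \<rho>" "h \<in> carrier G" "h \<noteq> \<one>\<^bsub>G\<^esub>"
  shows "\<exists>i<length bs. poly_act h (Var i) \<noteq> Var i"
proof (rule ccontr)
  interpret group_hom G "BijGroup UNIV" \<rho> by (rule group_hom)
  assume "\<not> ?thesis"
  then have fix_Var: "poly_act h (Var i) = Var i" if "i < length bs" for i using that by blast
  \<comment> \<open>\<open>poly_act h\<close> is defined by the matrix of the inverse, so it is the
    inverse that is shown to act trivially.\<close>
  let ?h = "inv\<^bsub>G\<^esub> h"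
  have h: "?h \<in> carrier G" using assms(2) by simp
  have basis: "coord i (\<rho> ?h (bs ! j)) = (if i = j then 1 else 0)"
    if "i < length bs" "j < length bs" for i j
    using fix_Var[OF that(1)] that(2)
    by (intro linear_form_eq_Var_coeff) (simp_all add: poly_act_def Const.eval_Var)
  have "coord i (\<rho> ?h v) = coord i v" if i: "i < length bs" for i v
  proof -
    have "coord i (\<rho> ?h v) = (\<Sum>j<length bs. coord j v * (if i = j then 1 else 0))"
      unfolding coord_action[OF h, of i v] using basis[OF i] by (intro sum.cong) auto
    also have "\<dots> = (\<Sum>j<length bs. if i = j then coord j v else 0)"
      by (intro sum.cong) auto
    finally show ?thesis using i by simp
  qed
  then have "\<rho> ?h v = v" for v
    using coord_expansion[of "\<rho> ?h v"] coord_expansion[of v] by simp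
  moreover have "\<rho> \<one>\<^bsub>G\<^esub> v = v" for v
    using id_eq_one by (metis UNIV_I restrict_apply')
  ultimately have "\<rho> ?h = \<rho> \<one>\<^bsub>G\<^esub>" by auto
  then have "?h = \<one>\<^bsub>G\<^esub>"
    by (rule inj_onD[OF faithful_action.faithful[OF assms(1)]]) (use h in auto)
  then show False using assms(2,3) by simp
qed

text \<open>The factor indexed by h vanishes at g = h, while no factor vanishes at the unit;
  dividing by the value there gives \<open>delta_one\<close>. Every factor costs one degree, so the
  bound reached is |G| - 1.\<close>

lemma delta_one_orbit_function:
  assumes "faithful_action G UNIV \<rho>" "finite (carrier G)"
  shows "\<exists>d. delta_one \<in> orbit_functions d"
proof -
  interpret G: group G by (rule G_group)
  obtain i where i: "\<And>h. h \<in> carrier G \<Longrightarrow> h \<noteq> \<one>\<^bsub>G\<^esub> \<Longrightarrow>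
      i h < length bs \<and> poly_act h (Var (i h)) \<noteq> Var (i h)"
    using moves_coordinate[OF assms(1)] by metis
  define x where "x h = (Var (i h) :: 'k mpoly)" for h
  have x: "x h \<in> poly_ring_le 1" "x h \<in> poly_ring" "poly_act h (x h) \<noteq> x h"
    if "h \<in> carrier G - {\<one>\<^bsub>G\<^esub>}" for h
    using that i[of h] bounded_polys_Var[of "i h" "{..<length bs}"]
    by (auto simp: x_def poly_ring_le_eq poly_ring_eq)
  have prod: "(\<lambda>g. emb (\<Prod>h\<in>H. poly_act g (x h) - poly_act h (x h))) \<in> orbit_functions (card H)"
    if "finite H" "H \<subseteq> carrier G - {\<one>\<^bsub>G\<^esub>}" for H
    using that
  proof (induction H)
    case empty
    \<comment> \<open>The empty product is the orbit map of the polynomial 1, of degree 0.\<close>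
    have "(\<lambda>g. emb (poly_act g 1)) \<in> orbit_functions 0"
      by (rule orbit_functions_poly_act) (simp add: poly_ring_le_eq bounded_polys_one)
    then show ?case by (simp add: poly_act_lin_subst lin_subst_one)
  next
    case (insert h H)
    let ?P = "\<lambda>g. emb (\<Prod>h\<in>H. poly_act g (x h) - poly_act h (x h))"
    have P: "?P \<in> orbit_functions (card H)" using insert by simp
    have "- poly_act h (x h) \<in> poly_ring"
      using insert.prems x by (intro poly_ring_uminus poly_act_in_poly_ring) auto
    \<comment> \<open>In the new factor, \<open>poly_act h (x h)\<close> does not depend on
      \<open>g\<close> and so acts as a scalar; only \<open>poly_act g (x h)\<close> raises the
      degree.\<close>
    then have "(\<lambda>g. emb (- poly_act h (x h)) * ?P g) \<in> orbit_functions (1 + card H)"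
      by (intro orbit_functions_scale orbit_functions_mono[OF P] emb_in_frac_field) auto
    moreover have "(\<lambda>g. emb (poly_act g (x h)) * ?P g) \<in> orbit_functions (1 + card H)"
      using insert.prems x by (intro orbit_functions_mult_poly_act P) auto
    ultimately have "(\<lambda>g. emb (poly_act g (x h)) * ?P g + emb (- poly_act h (x h)) * ?P g)
        \<in> orbit_functions (1 + card H)"
      by (intro orbit_functions_add)
    then show ?case
      using insert.hyps by (simp add: distrib_right flip: emb_mult emb_add)
        (simp add: left_diff_distrib)
  qed
  let ?H = "carrier G - {\<one>\<^bsub>G\<^esub>}"
  let ?Q = "\<lambda>g. \<Prod>h\<in>?H. poly_act g (x h) - poly_act h (x h)"
  have Q1: "?Q \<one>\<^bsub>G\<^esub> = (\<Prod>h\<in>?H. x h - poly_act h (x h))"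
    using x by (intro prod.cong) (auto simp: poly_act_one)
  have Q1_ring: "?Q \<one>\<^bsub>G\<^esub> \<in> poly_ring"
    unfolding Q1
  proof (rule poly_ring_prod)
    fix h assume "h \<in> ?H"
    then have "x h + - poly_act h (x h) \<in> poly_ring"
      using x(2) by (intro poly_ring_add poly_ring_uminus poly_act_in_poly_ring)
    then show "x h - poly_act h (x h) \<in> poly_ring" by simp
  qed
  have Q1_nz: "?Q \<one>\<^bsub>G\<^esub> \<noteq> 0"
    unfolding Q1 using x(3)[symmetric] assms(2) by simp
  have Q0: "?Q g = 0" if "g \<in> ?H" for g
    using that assms(2) by (intro prod_zero bexI[of _ g]) auto
  have "(\<lambda>g. inverse (emb (?Q \<one>\<^bsub>G\<^esub>)) * emb (?Q g)) \<in> orbit_functions (card ?H)"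
    using frac_fieldI[OF poly_ring_one Q1_ring Q1_nz] assms(2)
    by (intro orbit_functions_scale prod) (auto simp: inverse_eq_divide)
  then have "delta_one \<in> orbit_functions (card ?H)"
    by (rule orbit_functions_cong) (use Q1_nz Q0 in \<open>auto simp: delta_one_def\<close>)
  then show ?thesis ..
qed

text \<open>A dual system of some degree e shows that the \<open>LEAST\<close> is attained. The
  spanning set of that minimal degree then allows the same system to be rewritten in it.\<close>

lemma spanning_degree_delta_one:
  assumes "faithful_action G UNIV \<rho>" "finite (carrier G)"
  shows "delta_one \<in> orbit_functions spanning_degree"
proof -
  obtain e where e: "delta_one \<in> orbit_functions e"
    using delta_one_orbit_function[OF assms] by blast
  have "span_over invariant_field ((\<lambda>p. Fract p 1) ` poly_ring_le spanning_degree) = frac_field"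
    unfolding spanning_degree_def by (rule LeastI) (rule spans_if_delta_one[OF assms(2) e])
  then show ?thesis using e by (rule orbit_functions_if_spans)
qed

lemma spanning_degree_le:
  "finite (carrier G) \<Longrightarrow> delta_one \<in> orbit_functions d \<Longrightarrow> spanning_degree \<le> d"
  unfolding spanning_degree_def by (rule Least_le) (rule spans_if_delta_one)

end

section \<open>Transfer of a dual system along the pullback from k[V] to k[W]\<close>

theorem theorem4p4:
  fixes G :: "('g, 'm) monoid_scheme"
    and scaleV :: "'k::field \<Rightarrow> 'v::ab_group_add \<Rightarrow> 'v"
    and \<rho>V :: "'g \<Rightarrow> 'v \<Rightarrow> 'v" and basisV :: "'v list"
    and scaleW :: "'k \<Rightarrow> 'w::ab_group_add \<Rightarrow> 'w"
    and \<rho>W :: "'g \<Rightarrow> 'w \<Rightarrow> 'w" and basisW :: "'w list"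
    and \<phi> :: "'w \<Rightarrow> 'v"
  assumes "group G" and "finite (carrier G)"
    and "fin_dim_rep G scaleV \<rho>V basisV"
    and "fin_dim_rep G scaleW \<rho>W basisW"
    and "faithful_action G UNIV \<rho>V"
    and "Vector_Spaces.linear scaleW scaleV \<phi>"
    and "\<forall>g\<in>carrier G. \<forall>w. \<phi> (\<rho>W g w) = \<rho>V g (\<phi> w)"
    and "surj \<phi>"
  shows "fin_dim_rep.spanning_degree G scaleW \<rho>W basisW
           \<le> fin_dim_rep.spanning_degree G scaleV \<rho>V basisV"
proof -
  interpret V: fin_dim_rep G scaleV \<rho>V basisV by fact
  interpret W: fin_dim_rep G scaleW \<rho>W basisW by fact
  interpret \<phi>: Vector_Spaces.linear scaleW scaleV \<phi> by fact
  interpret G: group G by fact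
  let ?d = V.spanning_degree
  \<comment> \<open>Composition of polynomial functions with \<open>\<phi>\<close>, in coordinates:
    \<open>x\<^sub>i\<close> goes to the \<open>i\<close>-th coordinate of \<open>\<phi>\<close> as
    a linear form on W.\<close>
  define pull where "pull = lin_subst (length basisW) (\<lambda>i j. V.coord i (\<phi> (basisW ! j)))"
  have coord_\<phi>: "V.coord i (\<phi> w) = (\<Sum>j<length basisW. W.coord j w * V.coord i (\<phi> (basisW ! j)))" for i w
    using arg_cong[OF W.coord_expansion[of w], of \<phi>] by (simp add: \<phi>.sum \<phi>.scale V.coord_linear)
  have pull_le: "pull p \<in> W.poly_ring_le d" if "p \<in> V.poly_ring_le d" for p d
    using that unfolding pull_def W.poly_ring_le_eq
    by (intro lin_subst_bounded) (simp add: V.poly_ring_le_def)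
  have pull_ring: "pull p \<in> W.poly_ring" if "p \<in> V.poly_ring" for p
    using that pull_le unfolding V.poly_ring_eq W.poly_ring_eq V.poly_ring_le_eq W.poly_ring_le_eq
    by blast
  have pull_act: "pull (V.poly_act g p) = W.poly_act g (pull p)" if "g \<in> carrier G" for g p
  proof -
    have g: "inv\<^bsub>G\<^esub> g \<in> carrier G" using that by simp
    \<comment> \<open>Equality of the two matrix products, read off by expanding both sides of the
      equivariance of \<open>\<phi>\<close> at a basis vector of W.\<close>
    have "(\<Sum>j<length basisV. V.coord i (\<rho>V (inv\<^bsub>G\<^esub> g) (basisV ! j)) * V.coord j (\<phi> (basisW ! l)))
        = (\<Sum>j<length basisW. V.coord i (\<phi> (basisW ! j)) * W.coord j (\<rho>W (inv\<^bsub>G\<^esub> g) (basisW ! l)))" for i l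
    proof -
      have "V.coord i (\<rho>V (inv\<^bsub>G\<^esub> g) (\<phi> (basisW ! l))) = V.coord i (\<phi> (\<rho>W (inv\<^bsub>G\<^esub> g) (basisW ! l)))"
        using assms(7) g by simp
      then show ?thesis
        using V.coord_action[OF g, of i "\<phi> (basisW ! l)"] coord_\<phi>[of i "\<rho>W (inv\<^bsub>G\<^esub> g) (basisW ! l)"]
        by (simp only: mult.commute)
    qed
    then show ?thesis
      by (simp add: pull_def V.poly_act_lin_subst W.poly_act_lin_subst lin_subst_compose)
  qed
  have pull_nonzero: "pull p \<noteq> 0" if p: "p \<in> V.poly_ring" "p \<noteq> 0" for p
  proof
    assume 0: "pull p = 0"
    obtain \<psi> where \<psi>: "\<And>v. \<phi> (\<psi> v) = v" using assms(8) by (metis surjD)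
    \<comment> \<open>The coordinates of chosen preimages of the basis of V form a right inverse of
      the matrix of \<open>\<phi>\<close>. Substituting by it undoes \<open>pull\<close>, which is
      therefore injective.\<close>
    let ?B = "\<lambda>j l. W.coord j (\<psi> (basisV ! l))"
    have "(\<Sum>j<length basisW. V.coord i (\<phi> (basisW ! j)) * ?B j l) = (if i = l then 1 else 0)"
      if "i < length basisV" "l < length basisV" for i l
      using coord_\<phi>[of i "\<psi> (basisV ! l)"] that by (simp add: \<psi> V.coord_basis mult.commute)
    then have "lin_subst (length basisV) ?B (pull p)
        = lin_subst (length basisV) (\<lambda>i l. if i = l then 1 else 0) p"
      unfolding pull_def lin_subst_compose
      using p by (intro lin_subst_cong[where m = "length basisV"]) (auto simp: V.poly_ring_def)
    also have "\<dots> = p" using p by (intro lin_subst_id) (simp add: V.poly_ring_def)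
    finally show False using 0 p(2) by (simp add: lin_subst_zero)
  qed
  obtain q ps where q: "q \<in> V.poly_ring" "q \<noteq> 0" and ps: "set ps \<subseteq> V.poly_ring \<times> V.poly_ring_le ?d"
    and eq: "\<And>g. g \<in> carrier G \<Longrightarrow> emb q * V.delta_one g = emb (\<Sum>(p, s)\<leftarrow>ps. p * V.poly_act g s)"
    using V.orbit_functions_clear_denominators[OF V.spanning_degree_delta_one[OF assms(5,2)]] by metis
  \<comment> \<open>The system carried over to W; its denominator \<open>pull q\<close> is nonzero
    by injectivity.\<close>
  let ?qs = "map (\<lambda>(p, s). (emb (pull p) / emb (pull q), pull s)) ps"
  have "W.delta_one \<in> W.orbit_functions ?d"
  proof (rule W.orbit_functionsI)
    show "set ?qs \<subseteq> W.frac_field \<times> W.poly_ring_le ?d"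
      using ps q pull_nonzero[OF q] by (auto intro!: W.frac_fieldI pull_ring pull_le)
    fix g assume g: "g \<in> carrier G"
    have "emb (pull (\<Sum>(p, s)\<leftarrow>ps. p * V.poly_act g s)) / emb (pull q)
        = (\<Sum>(a, s)\<leftarrow>?qs. a * emb (W.poly_act g s))"
      by (induction ps) (auto simp: pull_def lin_subst_zero lin_subst_add lin_subst_mult emb_add emb_mult
          add_divide_distrib pull_act[OF g, unfolded pull_def])
    \<comment> \<open>The polynomial sum is q at the unit and 0 elsewhere, so its pullback divided
      by \<open>pull q\<close> is \<open>W.delta_one\<close>.\<close>
    moreover have "emb (\<Sum>(p, s)\<leftarrow>ps. p * V.poly_act g s) = emb (if g = \<one>\<^bsub>G\<^esub> then q else 0)"
      unfolding eq[OF g, symmetric] by (simp add: V.delta_one_def)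
    ultimately show "W.delta_one g = (\<Sum>(a, s)\<leftarrow>?qs. a * emb (W.poly_act g s))"
      using pull_nonzero[OF q] by (simp add: W.delta_one_def pull_def lin_subst_zero split: if_splits)
  qed
  then show ?thesis by (rule W.spanning_degree_le[OF assms(2)])
qed

end
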